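(* Let $T$ be a rationalizable data set over an $n\times n$ strategy space that satisfies the uniqueness property. Then $T$ can be rationalized by an $n\times n$ bimatrix game $(A,B)$ whose rank, $\operatorname{rank}(A+B)$, is at most the crossing span of $T$.
   Context: Write $[n]=\{1,\dots,n\}$. An $n\times n$ bimatrix game is a pair $(A,B)$ of real $n\times n$ matrices: $A$ is the payoff matrix of the row player and $B$ that of the column player. The rank of the game is the rank of the matrix $A+B$. A subgame is a pair $(I,J)$ with $I,J\subseteq[n]$. A data set $T$ (over an $n\times n$ strategy space) is a set of triples $((i,j),I,J)$, called observations, where $(I,J)$ is a subgame, $i\in I$ and $j\in J$; $(i,j)$ is the observed choice of the observation. A subgame $(I,J)$ is said to be in $T$ if it occurs in some observation of $T$. A profile $(i,j)\in I\times J$ is a strict (pure) Nash equilibrium of the subgame $(I,J)$ of $(A,B)$ if $A_{ij}>A_{i'j}$ for all $i'\in I\setminus\{i\}$ and $B_{ij}>B_{ij'}$ for all $j'\in J\setminus\{j\}$. The game $(A,B)$ rationalizes $T$ if for every $((i,j),I,J)\in T$ the profile $(i,j)$ is a strict Nash equilibrium of the subgame $(I,J)$. $T$ is rationalizable if some bimatrix game rationalizes it. A rationalizable data set $T$ satisfies the uniqueness property if for every subgame $(I,J)$ in $T$ there is exactly one observed choice $(i,j)$ (i.e. exactly one $(i,j)$ with $((i,j),I,J)\in T$), and moreover, whenever $((i,j),I,J),((i',j'),I',J')\in T$ with $I'\times J'\subseteq I\times J$ and $(i,j)\in I'\times J'$, then $(i',j')=(i,j)$. Two subgames $(I,J)$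 and $(I',J')$ cross if $(I\times J)\cap(I'\times J')\neq\emptyset$, $I\times J\not\subseteq I'\times J'$ and $I'\times J'\not\subseteq I\times J$. The crossing set of $T$ is the set of all subgames in $T$ that cross some subgame in $T$. Let $\mathcal{O}_C$ be the set of observed choices $(i,j)$ of observations of $T$ whose subgame lies in the crossing set. The crossing span of $T$ is $$\min\bigl\{\,|\{i : (i,j)\in\mathcal{O}_C \text{ for some } j\}|,\ |\{j : (i,j)\in\mathcal{O}_C\text{ for some } i\}|\,\bigr\}.$$ *)

theory Defs
  imports "HOL-Analysis.Analysis"
begin

text \<open>
  The strategy set \<open>[n]\<close> of both players is the universe of a finite type \<open>'n\<close>, so \<open>n = CARD('n)\<close>.
  For a payoff matrix \<open>A\<close>, the entry in row \<open>i\<close> and column \<open>j\<close> is \<open>A $ i $ j\<close>.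
\<close>

type_synonym 'n subgame = "'n set \<times> 'n set"
type_synonym 'n observation = "('n \<times> 'n) \<times> 'n subgame"

definition data_set :: "'n observation set \<Rightarrow> bool" where
  "data_set T \<longleftrightarrow> (\<forall>((i, j), I, J) \<in> T. i \<in> I \<and> j \<in> J)"

definition subgames :: "'n observation set \<Rightarrow> 'n subgame set" where
  "subgames T = {S. \<exists>c. (c, S) \<in> T}"

definition cells :: "'n subgame \<Rightarrow> ('n \<times> 'n) set" where
  "cells S = fst S \<times> snd S"

definition strict_nash ::
    "real^'n^'n \<Rightarrow> real^'n^'n \<Rightarrow> 'n subgame \<Rightarrow> 'n \<times> 'n \<Rightarrow> bool" where
  "strict_nash A B = (\<lambda>(I, J) (i, j). i \<in> I \<and> j \<in> J \<and>
     (\<forall>i' \<in> I - {i}. A $ i $ j > A $ i' $ j) \<and>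
     (\<forall>j' \<in> J - {j}. B $ i $ j > B $ i $ j'))"

definition rationalizes ::
    "real^'n^'n \<Rightarrow> real^'n^'n \<Rightarrow> 'n observation set \<Rightarrow> bool" where
  "rationalizes A B T \<longleftrightarrow> (\<forall>(c, S) \<in> T. strict_nash A B S c)"

definition rationalizable :: "('n::finite) observation set \<Rightarrow> bool" where
  "rationalizable T \<longleftrightarrow> (\<exists>A B. rationalizes A B T)"

definition uniqueness_property :: "'n observation set \<Rightarrow> bool" where
  "uniqueness_property T \<longleftrightarrow>
     (\<forall>S \<in> subgames T. \<exists>!c. (c, S) \<in> T) \<and>
     (\<forall>c S c' S'. (c, S) \<in> T \<longrightarrow> (c', S') \<in> T \<longrightarrow>
        cells S' \<subseteq> cells S \<longrightarrow> c \<in> cells S' \<longrightarrow> c' = c)"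

definition crosses :: "'n subgame \<Rightarrow> 'n subgame \<Rightarrow> bool" where
  "crosses S S' \<longleftrightarrow> cells S \<inter> cells S' \<noteq> {} \<and>
     \<not> cells S \<subseteq> cells S' \<and> \<not> cells S' \<subseteq> cells S"

definition crossing_set :: "'n observation set \<Rightarrow> 'n subgame set" where
  "crossing_set T = {S \<in> subgames T. \<exists>S' \<in> subgames T. crosses S S'}"

definition crossing_choices :: "'n observation set \<Rightarrow> ('n \<times> 'n) set" where
  "crossing_choices T = {c. \<exists>S \<in> crossing_set T. (c, S) \<in> T}"

definition crossing_span :: "'n observation set \<Rightarrow> nat" where
  "crossing_span T =
     min (card {i. \<exists>j. (i, j) \<in> crossing_choices T})
         (card {j. \<exists>i. (i, j) \<in> crossing_choices T})"

end

theory Submission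
  imports Defs
begin

text \<open>
  Let \<open>R\<close> be the set of rows of the crossing choices. Keeping a rationalizing \<open>B\<close> on the rows in
  \<open>R\<close> and setting \<open>B = - A\<close> on all other rows makes \<open>A + B\<close> vanish outside \<open>R\<close>, so its rank is at
  most \<open>card R\<close>. The matrix \<open>A\<close> then has to satisfy strict inequalities between cells; they are
  solvable unless they form a cycle. An observation whose choice lies in a row outside \<open>R\<close> has a
  subgame that crosses no other one. By uniqueness, a path of inequalities that enters a maximal
  such subgame \<open>N\<close> never leaves it, so a cycle that uses \<open>N\<close> stays in \<open>N\<close> and passes through its
  choice \<open>(i, j)\<close>. It leaves \<open>(i, j)\<close> along column \<open>j\<close>, downwards with respect to the given payoffs,
  and cannot return to row \<open>i\<close>: it either goes on descending in column \<open>j\<close>, or enters a subgame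
  which it cannot leave and which meets column \<open>j\<close> but, by uniqueness, not row \<open>i\<close>. The bound by
  the number of columns follows by exchanging the players.
\<close>

section \<open>The inequalities for the row player's payoffs\<close>

inductive_set payoff_above ::
    "'n set \<Rightarrow> 'n observation set \<Rightarrow> (('n \<times> 'n) \<times> ('n \<times> 'n)) set"
  for R :: "'n set" and K :: "'n observation set"
where
  column: "(c, S) \<in> K \<Longrightarrow> v \<in> cells S \<Longrightarrow> snd v = snd c \<Longrightarrow> v \<noteq> c \<Longrightarrow> (c, v) \<in> payoff_above R K"
| row: "(c, S) \<in> K \<Longrightarrow> fst c \<notin> R \<Longrightarrow> u \<in> cells S \<Longrightarrow> fst u = fst c \<Longrightarrow> u \<noteq> c
    \<Longrightarrow> (u, c) \<in> payoff_above R K"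

section \<open>Cycles and rankings of relations\<close>

lemma trancl_avoiding_or_through:
  assumes "(u, v) \<in> E\<^sup>+" and "\<And>x y. (x, y) \<in> E \<Longrightarrow> (x, y) \<in> E' \<or> x = c \<or> y = c"
  shows "(u, v) \<in> E'\<^sup>+ \<or> (u, c) \<in> E\<^sup>* \<and> (c, v) \<in> E\<^sup>*"
  using assms(1)
proof (induction rule: trancl_induct)
  case (base y)
  then show ?case using assms(2)[OF base] by blast
next
  case (step y z)
  then have uy: "(u, y) \<in> E\<^sup>*" and uz: "(u, z) \<in> E\<^sup>*"
    by (auto intro: trancl_into_rtrancl)
  from assms(2)[OF step(2)] consider "(y, z) \<in> E'" | "y = c" | "z = c" by blast
  then show ?case
  proof cases
    case 1
    then show ?thesis using step by (meson rtrancl.rtrancl_into_rtrancl trancl.trancl_into_trancl)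
  next
    case 2
    then show ?thesis using step(2) uy by blast
  next
    case 3
    then show ?thesis using uz by blast
  qed
qed

lemma cycle_through:
  assumes "(u, u) \<in> E\<^sup>+" and "acyclic E'"
    and "\<And>x y. (x, y) \<in> E \<Longrightarrow> (x, y) \<in> E' \<or> x = c \<or> y = c"
  shows "(c, c) \<in> E\<^sup>+"
proof -
  have "(u, c) \<in> E\<^sup>*" "(c, u) \<in> E\<^sup>*"
    using trancl_avoiding_or_through[OF assms(1,3)] assms(2) unfolding acyclic_def by blast+
  then show ?thesis
    using assms(1) by (meson rtrancl_trancl_trancl trancl_rtrancl_trancl)
qed

text \<open>Count the cells reachable from a point: a step from \<open>u\<close> to \<open>v\<close>
  loses at least \<open>v\<close>, which lies on no cycle.\<close>

lemma acyclic_ranking: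
  fixes E :: "('a::finite \<times> 'a) set"
  assumes "acyclic E"
  obtains f :: "'a \<Rightarrow> real" where "\<And>u v. (u, v) \<in> E \<Longrightarrow> f v < f u"
proof -
  have "card {w. (v, w) \<in> E\<^sup>+} < card {w. (u, w) \<in> E\<^sup>+}" if "(u, v) \<in> E" for u v
  proof (rule psubset_card_mono)
    have "v \<notin> {w. (v, w) \<in> E\<^sup>+}" using assms unfolding acyclic_def by simp
    moreover have "v \<in> {w. (u, w) \<in> E\<^sup>+}" using that by auto
    moreover have "{w. (v, w) \<in> E\<^sup>+} \<subseteq> {w. (u, w) \<in> E\<^sup>+}"
      using that by (auto intro: trancl_into_trancl2)
    ultimately show "{w. (v, w) \<in> E\<^sup>+} \<subset> {w. (u, w) \<in> E\<^sup>+}" by blast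
  qed simp
  then show ?thesis
    by (intro that[of "\<lambda>u. real (card {w. (u, w) \<in> E\<^sup>+})"]) simp
qed

section \<open>Subgames that trap paths of inequalities\<close>

locale rationalized_data =
  fixes T :: "('n::finite) observation set" and A B :: "real^'n^'n" and R :: "'n set"
  assumes rationalizes: "rationalizes A B T"
    and unique: "uniqueness_property T"
    and crossing_rows: "fst ` crossing_choices T \<subseteq> R"
begin

lemma strict_nash: "(c, S) \<in> T \<Longrightarrow> strict_nash A B S c"
  using rationalizes unfolding rationalizes_def by blast

lemma choice_in_cells: "(c, S) \<in> T \<Longrightarrow> c \<in> cells S"
  using strict_nash[of c S] by (cases c; cases S) (simp add: strict_nash_def cells_def)

lemma column_payoff_less:
  "(c, S) \<in> T \<Longrightarrow> v \<in> cells S \<Longrightarrow> snd v = snd c \<Longrightarrow> v \<noteq> c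
    \<Longrightarrow> A $ fst v $ snd v < A $ fst c $ snd c"
  using strict_nash[of c S]
  by (cases c; cases S; cases v) (simp add: strict_nash_def cells_def)

lemma choice_unique:
  "(c, S) \<in> T \<Longrightarrow> (c', S') \<in> T \<Longrightarrow> cells S' \<subseteq> cells S \<Longrightarrow> c \<in> cells S' \<Longrightarrow> c' = c"
  using unique unfolding uniqueness_property_def by blast

text \<open>Otherwise \<open>N\<close> would be in the crossing set and the row of its choice in
  \<open>R\<close>.\<close>

lemma nested_or_disjoint:
  assumes "(c, N) \<in> T" "fst c \<notin> R" "(c', S) \<in> T" "cells S \<inter> cells N \<noteq> {}"
  shows "cells S \<subseteq> cells N \<or> cells N \<subseteq> cells S"
proof (rule ccontr)
  assume "\<not> ?thesis"
  then have "crosses N S" using assms(4) unfolding crosses_def by blast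
  then have "c \<in> crossing_choices T"
    using assms(1,3) unfolding crossing_choices_def crossing_set_def subgames_def by blast
  then show False using crossing_rows assms(2) by blast
qed

text \<open>\<open>N\<close> competes only with observations whose choice lies off \<open>R\<close>;
  a subgame with its choice in \<open>R\<close> may still properly contain \<open>N\<close>.\<close>

definition maximal_in :: "'n observation set \<Rightarrow> ('n \<times> 'n) \<Rightarrow> 'n subgame \<Rightarrow> bool" where
  "maximal_in K c N \<longleftrightarrow> (c, N) \<in> K \<and> fst c \<notin> R \<and>
     (\<forall>(c', S) \<in> K. fst c' \<notin> R \<longrightarrow> cells N \<subseteq> cells S \<longrightarrow> cells S \<subseteq> cells N)"

lemma maximal_in_above:
  assumes "(c, S) \<in> K" "fst c \<notin> R"
  obtains c' N where "maximal_in K c' N" "cells S \<subseteq> cells N"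
proof -
  let ?X = "{cells S | c S. (c, S) \<in> K \<and> fst c \<notin> R}"
  have "finite ?X" by simp
  moreover have "cells S \<in> ?X" using assms by blast
  ultimately obtain m where "m \<in> ?X" "cells S \<subseteq> m"
    and max: "\<forall>b \<in> ?X. m \<subseteq> b \<longrightarrow> m = b"
    using finite_has_maximal2[of ?X "cells S"] by blast
  then obtain c' N where N: "m = cells N" "(c', N) \<in> K" "fst c' \<notin> R" by blast
  then have "maximal_in K c' N" using max unfolding maximal_in_def by blast
  then show ?thesis using that N(1) \<open>cells S \<subseteq> m\<close> by blast
qed

text \<open>\<open>(d, S)\<close> is the observation behind an inequality starting at
  \<open>u\<close>: \<open>d = u\<close> for a column step, \<open>fst d \<notin> R\<close> for a
  row step. If \<open>S\<close> stuck out of \<open>N\<close>, it would contain \<open>N\<close>,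
  and maximality would put the row of \<open>d\<close> in \<open>R\<close>. Then
  \<open>d = u\<close> lies in \<open>N\<close>, so uniqueness gives \<open>d = c\<close>, whose row
  is off \<open>R\<close>.\<close>

lemma label_within_maximal:
  assumes K: "K \<subseteq> T" and N: "maximal_in K c N"
    and S: "(d, S) \<in> K" and uS: "u \<in> cells S" and uN: "u \<in> cells N"
    and d: "d = u \<or> fst d \<notin> R"
  shows "cells S \<subseteq> cells N"
proof (rule ccontr)
  assume out: "\<not> cells S \<subseteq> cells N"
  have N': "(c, N) \<in> T" "fst c \<notin> R" using K N by (auto simp: maximal_in_def)
  have sub: "cells N \<subseteq> cells S"
    using nested_or_disjoint[OF N', of d S] S K uS uN out by blast
  have "fst d \<in> R" using N S sub out by (fastforce simp: maximal_in_def)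
  with d have "d = u" by blast
  then have "c = d" using choice_unique[of d S c N] S K N' sub uN by blast
  with N' \<open>fst d \<in> R\<close> show False by simp
qed

lemma step_within_maximal:
  assumes K: "K \<subseteq> T" and N: "maximal_in K c N"
    and uN: "u \<in> cells N" and uv: "(u, v) \<in> payoff_above R K"
  shows "v \<in> cells N \<and> (u, v) \<in> payoff_above R {(d, S) \<in> K. cells S \<subseteq> cells N}"
  using uv
proof cases
  case (column S)
  then have "cells S \<subseteq> cells N"
    using label_within_maximal[OF K N, of u S u] choice_in_cells[of u S] K uN by blast
  then show ?thesis using column by (auto intro: payoff_above.column[of u S])
next
  case (row S)
  then have "cells S \<subseteq> cells N"
    using label_within_maximal[OF K N, of v S u] uN by blast
  then show ?thesis using row choice_in_cells[of v S] K
    by (auto intro: payoff_above.row[of v S])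
qed

lemma path_within_maximal:
  assumes K: "K \<subseteq> T" and N: "maximal_in K c N"
    and uN: "u \<in> cells N" and uv: "(u, v) \<in> (payoff_above R K)\<^sup>+"
  shows "v \<in> cells N \<and> (u, v) \<in> (payoff_above R {(d, S) \<in> K. cells S \<subseteq> cells N})\<^sup>+"
  using uv
proof (induction rule: trancl_induct)
  case (base y)
  then show ?case using step_within_maximal[OF K N uN] by blast
next
  case (step y z)
  then show ?case using step_within_maximal[OF K N, of y z]
    by (meson trancl.trancl_into_trancl)
qed

section \<open>Acyclicity of the inequalities\<close>

lemma no_cycle_through_choice:
  assumes K: "K \<subseteq> T" and N: "(c, N) \<in> T"
    and within: "\<And>d S. (d, S) \<in> K \<Longrightarrow> cells S \<subseteq> cells N"
  shows "(c, c) \<notin> (payoff_above R K)\<^sup>+"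
proof
  assume "(c, c) \<in> (payoff_above R K)\<^sup>+"
  then obtain w where cw: "(c, w) \<in> payoff_above R K" and wc: "(w, c) \<in> (payoff_above R K)\<^sup>*"
    by (meson tranclD)
  \<comment> \<open>Steps starting off the row of \<open>c\<close> come from \<open>?K\<close>,
    since the choice behind a step shares the row of its start. No subgame in \<open>?K\<close>
    contains \<open>c\<close>, as uniqueness would make \<open>c\<close> its choice.\<close>
  let ?K = "{(d, S) \<in> K. fst d \<noteq> fst c}"
  \<comment> \<open>After the first step the path is always \<open>descending\<close> or
    \<open>trapped\<close>, and both states exclude the row of \<open>c\<close>.\<close>
  define descending where "descending v \<longleftrightarrow>
      snd v = snd c \<and> A $ fst v $ snd v < A $ fst c $ snd c" for v
  define trapped where "trapped v \<longleftrightarrow>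
      (\<exists>d M. maximal_in ?K d M \<and> v \<in> cells M \<and> snd c \<in> snd M)" for v
  have KT: "?K \<subseteq> T" using K by auto
  have off_row: "fst v \<noteq> fst c" if v: "descending v \<or> trapped v" for v
  proof
    assume eq: "fst v = fst c"
    have "\<not> descending v" using eq unfolding descending_def by auto
    then obtain d M where M: "maximal_in ?K d M" "v \<in> cells M" "snd c \<in> snd M"
      using v unfolding trapped_def by blast
    have "c \<in> cells M" using M eq by (auto simp: cells_def mem_Times_iff)
    moreover have "(d, M) \<in> K" "fst d \<noteq> fst c" using M(1) by (auto simp: maximal_in_def)
    ultimately show False using choice_unique[OF N, of d M] within K by blast
  qed
  have "descending w"
    using cw
  proof cases
    case (column S)
    then show ?thesis
      using column_payoff_less[of c S w] K by (auto simp: descending_def)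
  next
    case (row S)
    \<comment> \<open>A row step out of \<open>c\<close> would end at the choice of a subgame that
      lies in \<open>N\<close> and contains \<open>c\<close>, so it would end at
      \<open>c\<close>.\<close>
    then show ?thesis using choice_unique[OF N, of w S] within K by blast
  qed
  have step: "descending v \<or> trapped v"
    if uv: "(u, v) \<in> payoff_above R K" and u: "descending u \<or> trapped u" for u v
  proof -
    have off: "fst u \<noteq> fst c" using off_row u by blast
    have uv': "(u, v) \<in> payoff_above R ?K"
      using uv off by cases (auto intro: payoff_above.intros)
    show ?thesis
    proof (cases "trapped u")
      case True
      then show ?thesis
        using step_within_maximal[OF KT _ _ uv'] unfolding trapped_def by blast
    next
      case False
      with u have desc: "descending u" by blast
      show ?thesis
        using uv'
      proof cases
        case (column S)
        then have "A $ fst v $ snd v < A $ fst u $ snd u"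
          using column_payoff_less[of u S v] KT by blast
        then show ?thesis using desc column unfolding descending_def by auto
      next
        case (row S)
        \<comment> \<open>The step leaves the column of \<open>c\<close>, but its choice is off
          \<open>R\<close>, so some maximal \<open>M\<close> traps it. \<open>M\<close> meets that
          column in \<open>u\<close>.\<close>
        obtain d M where M: "maximal_in ?K d M" "cells S \<subseteq> cells M"
          using maximal_in_above[OF row(1,2)] by blast
        have "u \<in> cells M" using row M by blast
        moreover have "v \<in> cells M"
          using step_within_maximal[OF KT M(1) _ uv'] calculation by blast
        moreover have "snd c \<in> snd M"
          using \<open>u \<in> cells M\<close> desc by (auto simp: cells_def descending_def mem_Times_iff)
        ultimately show ?thesis using M(1) unfolding trapped_def by blast
      qed
    qed
  qed
  have "descending c \<or> trapped c"
    using wc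
  proof (induction rule: rtrancl_induct)
    case base
    then show ?case using \<open>descending w\<close> by blast
  qed (use step in blast)
  then show False using off_row by blast
qed

lemma acyclic_payoff_above:
  assumes "K \<subseteq> T"
  shows "acyclic (payoff_above R K)"
  using finite[of K] assms
proof (induction K rule: finite_psubset_induct)
  case (psubset K)
  show ?case
  proof (cases "\<exists>(c, S) \<in> K. fst c \<notin> R")
    case False
    \<comment> \<open>Only column steps remain, and the given \<open>A\<close> decreases along
      them.\<close>
    have less: "A $ fst v $ snd v < A $ fst u $ snd u"
      if "(u, v) \<in> payoff_above R K" for u v
      using that
    proof cases
      case (column S)
      then show ?thesis using column_payoff_less[of u S v] psubset.prems by blast
    qed (use False in blast)
    have "A $ fst v $ snd v < A $ fst u $ snd u"
      if "(u, v) \<in> (payoff_above R K)\<^sup>+" for u v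
      using that by (induction rule: trancl_induct) (use less in \<open>force intro: less_trans\<close>)+
    then show ?thesis unfolding acyclic_def by (metis less_irrefl)
  next
    case True
    then obtain c N where N: "maximal_in K c N"
      using maximal_in_above by blast
    then have cN: "(c, N) \<in> K" by (simp add: maximal_in_def)
    have "K - {(c, N)} \<subset> K" using cN by blast
    then have ac: "acyclic (payoff_above R (K - {(c, N)}))"
      using psubset by blast
    show ?thesis
    proof (rule ccontr)
      assume "\<not> ?thesis"
      then obtain u where "(u, u) \<in> (payoff_above R K)\<^sup>+" unfolding acyclic_def by blast
      \<comment> \<open>Every inequality contributed by \<open>(c, N)\<close> has \<open>c\<close>
        as an endpoint.\<close>
      then have "(c, c) \<in> (payoff_above R K)\<^sup>+"
      proof (rule cycle_through[OF _ ac])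
        fix x y assume "(x, y) \<in> payoff_above R K"
        then show "(x, y) \<in> payoff_above R (K - {(c, N)}) \<or> x = c \<or> y = c"
          by cases (auto intro: payoff_above.intros)
      qed
      then have "(c, c) \<in> (payoff_above R {(d, S) \<in> K. cells S \<subseteq> cells N})\<^sup>+"
        using path_within_maximal[OF psubset.prems N] choice_in_cells[of c N] cN psubset.prems
        by blast
      moreover have "(c, c) \<notin> (payoff_above R {(d, S) \<in> K. cells S \<subseteq> cells N})\<^sup>+"
        by (rule no_cycle_through_choice[of _ c N]) (use cN psubset.prems in auto)
      ultimately show False by blast
    qed
  qed
qed

end

section \<open>The rank bounds\<close>

text \<open>The rows indexed by \<open>R\<close> span all rows, the others being zero.\<close>

lemma rank_le_card_rows:
  fixes C :: "real^'n^'m"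
  assumes "\<And>i. i \<notin> R \<Longrightarrow> row i C = 0"
  shows "rank C \<le> card R"
proof -
  have "rows C \<subseteq> span ((\<lambda>i. row i C) ` R)"
    using assms by (auto simp: rows_def intro: span_base span_zero)
      (metis imageI span_base span_zero)
  then have "dim (rows C) \<le> card ((\<lambda>i. row i C) ` R)"
    by (intro dim_le_card) auto
  also have "\<dots> \<le> card R" by (rule card_image_le) simp
  finally show ?thesis by (simp add: row_rank_def)
qed

lemma rationalizes_with_rank_le_rows:
  fixes T :: "('n::finite) observation set"
  assumes "rationalizable T" and "uniqueness_property T"
  shows "\<exists>A B :: real^'n^'n. rationalizes A B T \<and>
    rank (A + B) \<le> card {i. \<exists>j. (i, j) \<in> crossing_choices T}"
proof -
  let ?R = "{i. \<exists>j. (i, j) \<in> crossing_choices T}"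
  obtain A B where AB: "rationalizes A B T"
    using assms(1) unfolding rationalizable_def by blast
  interpret rationalized_data T A B ?R
    by standard (use AB assms(2) in auto)
  obtain f :: "'n \<times> 'n \<Rightarrow> real"
    where f: "\<And>u v. (u, v) \<in> payoff_above ?R T \<Longrightarrow> f v < f u"
    using acyclic_ranking[OF acyclic_payoff_above[OF order_refl]] by blast
  define A' :: "real^'n^'n" where "A' = (\<chi> i j. f (i, j))"
  define B' :: "real^'n^'n" where "B' = (\<chi> i j. if i \<in> ?R then B $ i $ j else - f (i, j))"
  have "strict_nash A' B' (I, J) (i, j)" if ob: "((i, j), I, J) \<in> T" for i j I J
  proof -
    have nash: "strict_nash A B (I, J) (i, j)"
      using AB ob unfolding rationalizes_def by blast
    have "f (p, j) < f (i, j)" if "p \<in> I - {i}" for p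
      by (rule f, rule payoff_above.column[OF ob])
        (use that nash in \<open>auto simp: cells_def strict_nash_def\<close>)
    \<comment> \<open>On rows in \<open>?R\<close> the column player's inequalities are inherited
      from \<open>B\<close>.\<close>
    moreover have "f (i, j) < f (i, q)" if "q \<in> J - {j}" "i \<notin> ?R" for q
      by (rule f, rule payoff_above.row[OF ob])
        (use that nash in \<open>auto simp: cells_def strict_nash_def\<close>)
    ultimately show ?thesis
      using nash by (auto simp: strict_nash_def A'_def B'_def)
  qed
  then have "rationalizes A' B' T" unfolding rationalizes_def by auto
  moreover have "rank (A' + B') \<le> card ?R"
    by (rule rank_le_card_rows) (simp add: row_def A'_def B'_def vec_eq_iff)
  ultimately show ?thesis by blast
qed

section \<open>Exchanging the players\<close>

definition swap_players :: "'n observation \<Rightarrow> 'n observation" where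
  "swap_players = map_prod prod.swap prod.swap"

lemma mem_swap_players_image:
  "(c, S) \<in> swap_players ` T \<longleftrightarrow> (prod.swap c, prod.swap S) \<in> T"
  by (force simp: swap_players_def image_iff)

lemma cells_swap: "cells (prod.swap S) = prod.swap ` cells S"
  by (auto simp: cells_def)

lemma cells_swap_subset: "cells (prod.swap S) \<subseteq> cells (prod.swap S') \<longleftrightarrow> cells S \<subseteq> cells S'"
  by (simp add: cells_swap inj_image_subset_iff)

lemma rationalizes_swap:
  "rationalizes (transpose B) (transpose A) (swap_players ` T) \<longleftrightarrow> rationalizes A B T"
proof -
  have "strict_nash (transpose B) (transpose A) (prod.swap S) (prod.swap c) \<longleftrightarrow> strict_nash A B S c"
    for c S
    by (cases c; cases S) (auto simp: strict_nash_def transpose_def)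
  then show ?thesis by (simp add: rationalizes_def swap_players_def split_beta)
qed

lemma uniqueness_property_swap:
  assumes "uniqueness_property T"
  shows "uniqueness_property (swap_players ` T)"
  unfolding uniqueness_property_def
proof (intro conjI ballI allI impI)
  fix S assume "S \<in> subgames (swap_players ` T)"
  then have "prod.swap S \<in> subgames T"
    unfolding subgames_def mem_swap_players_image by blast
  then obtain d where d: "(d, prod.swap S) \<in> T" "\<And>e. (e, prod.swap S) \<in> T \<Longrightarrow> e = d"
    using assms unfolding uniqueness_property_def by metis
  show "\<exists>!c. (c, S) \<in> swap_players ` T"
    unfolding mem_swap_players_image
    by (rule ex1I[of _ "prod.swap d"]) (use d in \<open>force+\<close>)
next
  fix c S c' S'
  assume "(c, S) \<in> swap_players ` T" "(c', S') \<in> swap_players ` T"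
    and "cells S' \<subseteq> cells S" "c \<in> cells S'"
  moreover from this have "prod.swap c \<in> cells (prod.swap S')" by (simp add: cells_swap)
  ultimately have "prod.swap c' = prod.swap c"
    using assms unfolding uniqueness_property_def mem_swap_players_image
    by (metis cells_swap_subset)
  then show "c' = c" by (metis swap_swap)
qed

lemma crosses_swap: "crosses (prod.swap S) (prod.swap S') \<longleftrightarrow> crosses S S'"
  by (simp add: crosses_def cells_swap inj_image_subset_iff flip: image_Int)

lemma ex_swap: "(\<exists>x. P (prod.swap x)) \<longleftrightarrow> (\<exists>x. P x)"
  by (metis swap_swap)

lemma subgames_swap: "S \<in> subgames (swap_players ` T) \<longleftrightarrow> prod.swap S \<in> subgames T"
  unfolding subgames_def mem_Collect_eq mem_swap_players_image
  by (rule ex_swap[of "\<lambda>c. (c, prod.swap S) \<in> T"])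

lemma crossing_set_swap:
  "S \<in> crossing_set (swap_players ` T) \<longleftrightarrow> prod.swap S \<in> crossing_set T"
  unfolding crossing_set_def mem_Collect_eq subgames_swap Bex_def
  using ex_swap[of "\<lambda>S'. S' \<in> subgames T \<and> crosses (prod.swap S) S'"]
  unfolding crosses_swap by blast

lemma crossing_choices_swap:
  "c \<in> crossing_choices (swap_players ` T) \<longleftrightarrow> prod.swap c \<in> crossing_choices T"
  unfolding crossing_choices_def mem_Collect_eq Bex_def crossing_set_swap mem_swap_players_image
  by (rule ex_swap[of "\<lambda>S. S \<in> crossing_set T \<and> (prod.swap c, S) \<in> T"])

lemma transpose_add: "transpose (A + B) = transpose A + transpose B"
  by (simp add: transpose_def vec_eq_iff)

theorem theorem4:
  fixes T :: "('n::finite) observation set"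
  assumes "data_set T"
    and "rationalizable T"
    and "uniqueness_property T"
  shows "\<exists>A B :: real^'n^'n. rationalizes A B T \<and> rank (A + B) \<le> crossing_span T"
proof -
  have "rationalizable (swap_players ` T)"
    using assms(2) unfolding rationalizable_def by (metis rationalizes_swap)
  \<comment> \<open>Rows of the exchanged data are columns of \<open>T\<close>, and transposing the
    game back preserves the rank.\<close>
  then obtain A B :: "real^'n^'n" where "rationalizes A B (swap_players ` T)"
    and "rank (A + B) \<le> card {j. \<exists>i. (j, i) \<in> crossing_choices (swap_players ` T)}"
    using rationalizes_with_rank_le_rows uniqueness_property_swap[OF assms(3)] by blast
  then have "rationalizes (transpose B) (transpose A) T"
    and "rank (transpose B + transpose A) \<le> card {j. \<exists>i. (i, j) \<in> crossing_choices T}"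
    by (simp_all add: crossing_choices_swap rank_transpose
        add.commute flip: rationalizes_swap[of "transpose A"] transpose_add)
  \<comment> \<open>The two bounds belong to different games; the smaller count decides which one is
    taken.\<close>
  then show ?thesis
    using rationalizes_with_rank_le_rows[OF assms(2,3)]
    unfolding crossing_span_def min_def by (auto intro: exI)
qed

end
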